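(* Let $n\ge 2$, let $K$ be a field, $S=K[x_1,\ldots,x_n]$ and $I_n=(x_1x_2,x_2x_3,\ldots,x_{n-1}x_n)\subset S$. Then: (1) $\operatorname{hdepth}(S/I_n)$ is the maximum of all integers $d$ with $0\le d\le n$ such that $\sum_{j=0}^k(-1)^{k-j}\binom{d-j}{k-j}\binom{n-j+1}{j}\ge 0$ for all $1\le k\le d$. (2) $\operatorname{hdepth}(I_n)$ is the maximum of all integers $d$ with $0\le d\le n$ such that $\sum_{j=0}^k(-1)^{k-j}\binom{d-j}{k-j}\binom{n-j+1}{j}\le\binom{n-d+k-1}{k}$ for all $2\le k\le d$.
   Context: $S$ has the standard grading. For a nonzero finitely generated graded $S$-module $M$ with Hilbert series $H_M(t)=\sum_i \dim_K(M_i)t^i$, the Hilbert depth is $\operatorname{hdepth}(M)=\max\{r\ge 0 : (1-t)^rH_M(t)\text{ has only nonnegative coefficients}\}$ (equivalently, the maximal depth of a finitely generated graded $S$-module with the same Hilbert series as $M$). Binomial coefficients: $\binom{a}{0}=1$ for every integer $a$, and $\binom{a}{b}=0$ if $b<0$, or if $b>0$ and $a<b$. *)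

theory Defs
  imports
    "HOL-Library.Poly_Mapping"
    "HOL-Computational_Algebra.Formal_Power_Series"
    "HOL-Algebra.QuotRing"
    "HOL-Algebra.Embedded_Algebras"
begin

text \<open>A monomial is its exponent vector, a finitely supported map from variable indices to
  exponents; a polynomial maps monomials to coefficients. The type has infinitely many variables;
  the ring in the variables with indices \<open>1, \<dots>, n\<close> is cut out by its carrier.\<close>

type_synonym 'k mpoly = "(nat \<Rightarrow>\<^sub>0 nat) \<Rightarrow>\<^sub>0 'k"

definition var :: "nat \<Rightarrow> 'k::field mpoly" where
  "var i = Poly_Mapping.single (Poly_Mapping.single i 1) 1"

definition poly_ring :: "nat \<Rightarrow> 'k::field mpoly ring" where
  "poly_ring n =
     \<lparr>carrier = {p. \<forall>m \<in> Poly_Mapping.keys p. Poly_Mapping.keys m \<subseteq> {1..n}},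
      mult = (*), one = 1, zero = 0, add = (+)\<rparr>"

definition poly_consts :: "'k::field mpoly set" where
  "poly_consts = {Poly_Mapping.single 0 c |c. True}"

definition mon_degree :: "(nat \<Rightarrow>\<^sub>0 nat) \<Rightarrow> nat" where
  "mon_degree m = (\<Sum>i\<in>Poly_Mapping.keys m. Poly_Mapping.lookup m i)"

definition homogeneous :: "nat \<Rightarrow> nat \<Rightarrow> 'k::field mpoly set" where
  "homogeneous n i =
     {p \<in> carrier (poly_ring n). \<forall>m \<in> Poly_Mapping.keys p. mon_degree m = i}"

definition path_ideal :: "nat \<Rightarrow> 'k::field mpoly set" where
  "path_ideal n = genideal (poly_ring n) {var i * var (Suc i) |i. 1 \<le> i \<and> i < n}"

text \<open>A graded module enters through the family \<open>M\<close> of its homogeneous components, each a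
  linear subspace of a ring \<open>R\<close> over a subfield \<open>K\<close> of \<open>R\<close>. This covers ideals (inside the
  polynomial ring) and quotient rings (inside themselves); \<open>ring.dim R K\<close> is then the usual
  dimension over \<open>K\<close>.\<close>

definition hilbert_series :: "('a, 'b) ring_scheme \<Rightarrow> 'a set \<Rightarrow> (nat \<Rightarrow> 'a set) \<Rightarrow> int fps" where
  "hilbert_series R K M = Abs_fps (\<lambda>i. int (ring.dim R K (M i)))"

definition hdepth :: "('a, 'b) ring_scheme \<Rightarrow> 'a set \<Rightarrow> (nat \<Rightarrow> 'a set) \<Rightarrow> nat" where
  "hdepth R K M =
     Max {r. \<forall>i. fps_nth ((1 - fps_X) ^ r * hilbert_series R K M) i \<ge> 0}"

definition hdepth_ideal :: "nat \<Rightarrow> 'k::field mpoly set \<Rightarrow> nat" where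
  "hdepth_ideal n I = hdepth (poly_ring n) poly_consts (\<lambda>i. I \<inter> homogeneous n i)"

text \<open>The field acts on the quotient through the classes of the constants; the component of
  degree \<open>i\<close> consists of the classes of the homogeneous polynomials of degree \<open>i\<close>.\<close>

definition hdepth_quotient :: "nat \<Rightarrow> 'k::field mpoly set \<Rightarrow> nat" where
  "hdepth_quotient n I =
     hdepth (poly_ring n Quot I)
       ((\<lambda>p. I +>\<^bsub>poly_ring n\<^esub> p) ` poly_consts)
       (\<lambda>i. (\<lambda>p. I +>\<^bsub>poly_ring n\<^esub> p) ` homogeneous n i)"

end

theory Submission
  imports Defs
begin

text \<open>
The ideal \<open>I\<^sub>n\<close> is the Stanley-Reisner ideal of the complex \<open>\<Delta>\<close> of stable sets of a path: a monomial
lies in \<open>I\<^sub>n\<close> iff its support contains two consecutive indices. So the monomials outside \<open>I\<^sub>n\<close>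
give a basis of \<open>S/I\<^sub>n\<close>, those inside give one of \<open>I\<^sub>n\<close>, and both Hilbert series are counts of
monomials sorted by support. The monomials with a fixed support of size \<open>j\<close> have generating
function \<open>(t/(1-t))\<^sup>j\<close>, hence both series have the form \<open>H = \<Sum>\<^sub>j a\<^sub>j (t/(1-t))\<^sup>j\<close> with
\<open>j \<le> n\<close>, where \<open>a\<^sub>j\<close> is the number of stable sets of size \<open>j\<close> for \<open>S/I\<^sub>n\<close>, and the number of
other subsets of size \<open>j\<close> for \<open>I\<^sub>n\<close>.

For such a series, multiplication by \<open>(1-t)\<^sup>d\<close> turns the summand \<open>j\<close> into
\<open>a\<^sub>j t\<^sup>j (1-t)\<^sup>d\<^sup>-\<^sup>j\<close>. The summands with \<open>j \<le> d\<close> are polynomials of degree at most \<open>d\<close>, the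
others have nonnegative coefficients; so a negative coefficient can only occur in a degree
\<open>k \<le> d\<close>, where for \<open>d \<le> n\<close> the coefficient is the alternating sum of the theorem, with \<open>a\<^sub>j\<close> in
place of the last binomial coefficient. If \<open>d > n\<close>, the product is a polynomial divisible by
\<open>1-t\<close>, and nonnegative coefficients would force it to vanish. This is
\<open>nonneg_exponents_face_series\<close>.

A path on \<open>n\<close> vertices has \<open>(n-j+1) choose j\<close> stable sets of size \<open>j\<close> (\<open>card_stable_sets\<close>), which
gives the first part; the coefficient for \<open>k = 0\<close> is 1. For the second part, \<open>a\<^sub>j\<close> is
\<open>n choose j\<close> minus that number, and the contribution of \<open>n choose j\<close> is the coefficient of
\<open>(1-t)\<^sup>d/(1-t)\<^sup>n\<close>, namely \<open>(n-d+k-1) choose k\<close> (\<open>alternating_sum_binomial\<close>). Here the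
coefficients for \<open>k = 0\<close> and \<open>k = 1\<close> vanish, since the ideal lives in degrees at least 2.
\<close>

section \<open>Power series with nonnegative coefficients\<close>

text \<open>The series \<open>1/(1-t)\<close>, over coefficients that have no inverse operation.\<close>

abbreviation geom :: "int fps" where "geom \<equiv> Abs_fps (\<lambda>_. 1)"

lemma one_minus_X_mult_nth_Suc: "fps_nth ((1 - fps_X) * f) (Suc k) = fps_nth f (Suc k) - fps_nth (f :: int fps) k"
  by (simp add: left_diff_distrib)

lemma one_minus_X_mult_nth_0: "fps_nth ((1 - fps_X) * f) 0 = fps_nth (f :: int fps) 0"
  by (simp add: left_diff_distrib)

lemma one_minus_X_mult_geom: "(1 - fps_X) * geom = 1"
proof (rule fps_ext)
  fix k show "fps_nth ((1 - fps_X) * geom) k = fps_nth 1 k"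
    by (cases k) (simp_all add: one_minus_X_mult_nth_Suc one_minus_X_mult_nth_0)
qed

lemma one_plus_X_geom: "1 + fps_X * geom = geom"
  using one_minus_X_mult_geom by (simp add: algebra_simps)

text \<open>The two cases of \<open>(1-t)\<^sup>a/(1-t)\<^sup>b\<close>, for \<open>a \<ge> b\<close> and for \<open>a \<le> b\<close>.\<close>

lemma one_minus_X_power_mult_geom_power:
  "(1 - fps_X) ^ (m + l) * geom ^ m = (1 - fps_X) ^ l"
  "(1 - fps_X) ^ m * geom ^ (m + l) = geom ^ l"
proof -
  have *: "(1 - fps_X) ^ m * geom ^ m = 1"
    by (simp add: one_minus_X_mult_geom flip: power_mult_distrib)
  have "(1 - fps_X) ^ (m + l) * geom ^ m = (1 - fps_X) ^ l * ((1 - fps_X) ^ m * geom ^ m)"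
    by (simp only: power_add ac_simps)
  then show "(1 - fps_X) ^ (m + l) * geom ^ m = (1 - fps_X) ^ l"
    by (simp only: * mult_1_right)
  have "(1 - fps_X) ^ m * geom ^ (m + l) = ((1 - fps_X) ^ m * geom ^ m) * geom ^ l"
    by (simp only: power_add ac_simps)
  then show "(1 - fps_X) ^ m * geom ^ (m + l) = geom ^ l"
    by (simp only: * mult_1_left)
qed

lemma one_minus_X_power_nth:
  "fps_nth ((1 - fps_X) ^ m :: int fps) k = (-1) ^ k * int (m choose k)"
proof (induction m arbitrary: k)
  case 0
  show ?case by (cases k) auto
next
  case (Suc m)
  show ?case
    by (cases k) (simp_all add: one_minus_X_mult_nth_Suc one_minus_X_mult_nth_0 Suc.IH algebra_simps)
qed

text \<open>Truncated subtraction makes the formula right also for \<open>m = 0\<close>: \<open>(k - 1) choose k\<close> is 1 for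
  \<open>k = 0\<close> and 0 otherwise.\<close>

lemma geom_power_nth: "fps_nth (geom ^ m) k = int ((m + k - 1) choose k)"
proof (induction m arbitrary: k)
  case 0
  show ?case by (cases k) auto
next
  case (Suc m)
  note outer = Suc.IH
  have step: "fps_nth (geom ^ Suc m) (Suc k) = fps_nth (geom ^ m) (Suc k) + fps_nth (geom ^ Suc m) k" for k
  proof -
    have "geom ^ m = (1 - fps_X) * geom ^ Suc m"
      by (simp add: mult.assoc[symmetric] one_minus_X_mult_geom)
    then have "fps_nth (geom ^ m) (Suc k) = fps_nth (geom ^ Suc m) (Suc k) - fps_nth (geom ^ Suc m) k"
      by (simp only: one_minus_X_mult_nth_Suc)
    then show ?thesis by simp
  qed
  show ?case
  proof (induction k)
    case 0
    show ?case by (simp add: fps_nth_power_0)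
  next
    case (Suc k)
    have "fps_nth (geom ^ Suc m) (Suc k) = int ((m + k) choose Suc k) + int ((m + k) choose k)"
      unfolding step Suc.IH outer by simp
    also have "\<dots> = int ((Suc m + Suc k - 1) choose Suc k)"
      by (simp add: add.commute)
    finally show ?case .
  qed
qed

text \<open>The Hilbert series of the span of all monomials whose support belongs to a family of subsets of
  \<open>{1..n}\<close> with \<open>a j\<close> members of size \<open>j\<close>.\<close>

definition face_series :: "nat \<Rightarrow> (nat \<Rightarrow> nat) \<Rightarrow> int fps" where
  "face_series n a = (\<Sum>j\<le>n. of_nat (a j) * (fps_X * geom) ^ j)"

lemma one_minus_X_power_mult_face_term_nth:
  "fps_nth ((1 - fps_X) ^ d * (fps_X * geom) ^ j) k =
     (if k < j then 0
      else if j \<le> d then (-1) ^ (k - j) * int ((d - j) choose (k - j))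
      else fps_nth (geom ^ (j - d)) (k - j))"
proof -
  have "(1 - fps_X) ^ d * geom ^ j = (if j \<le> d then (1 - fps_X) ^ (d - j) else geom ^ (j - d))"
    using one_minus_X_power_mult_geom_power(1)[of j "d - j"]
      one_minus_X_power_mult_geom_power(2)[of d "j - d"] by auto
  then have "(1 - fps_X) ^ d * (fps_X * geom) ^ j =
      fps_X ^ j * (if j \<le> d then (1 - fps_X) ^ (d - j) else geom ^ (j - d))"
    by (simp add: power_mult_distrib mult.left_commute)
  then show ?thesis
    by (simp add: fps_X_power_mult_nth one_minus_X_power_nth)
qed

lemma one_minus_X_power_mult_face_series_nth:
  "fps_nth ((1 - fps_X) ^ d * face_series n a) k =
     (\<Sum>j\<le>n. int (a j) * fps_nth ((1 - fps_X) ^ d * (fps_X * geom) ^ j) k)"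
proof -
  have "(1 - fps_X) ^ d * face_series n a =
      (\<Sum>j\<le>n. fps_const (int (a j)) * ((1 - fps_X) ^ d * (fps_X * geom) ^ j))"
    by (simp add: face_series_def sum_distrib_left mult.left_commute fps_of_nat)
  then show ?thesis by (simp add: fps_sum_nth)
qed

lemma one_minus_X_power_mult_face_series_nth_le:
  assumes "k \<le> d" "k \<le> n"
  shows "fps_nth ((1 - fps_X) ^ d * face_series n a) k =
     (\<Sum>j=0..k. (-1) ^ (k - j) * int ((d - j) choose (k - j)) * int (a j))"
  unfolding one_minus_X_power_mult_face_series_nth
  by (rule sum.mono_neutral_cong_right) (use assms in \<open>auto simp: one_minus_X_power_mult_face_term_nth\<close>)

text \<open>Above degree \<open>d\<close>, the summands with \<open>j \<le> d\<close> are polynomials of too small degree to contribute,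
  and the summands with \<open>j > d\<close> are products of powers of \<open>t\<close> and of the geometric series.\<close>

lemma one_minus_X_power_mult_face_series_nth_gt:
  assumes "d < k"
  shows "fps_nth ((1 - fps_X) ^ d * face_series n a) k \<ge> 0"
  unfolding one_minus_X_power_mult_face_series_nth one_minus_X_power_mult_face_term_nth
  by (rule sum_nonneg) (use assms in \<open>auto simp: geom_power_nth binomial_eq_0\<close>)

lemma face_series_nonzero:
  assumes "j \<le> n" "a j \<noteq> 0"
  shows "face_series n a \<noteq> 0"
proof -
  have term_nth: "fps_nth ((1 - fps_X) ^ 0 * (fps_X * geom) ^ i) k =
      (if k < i then 0 else int ((k - 1) choose (k - i)))" for i k
    by (simp add: power_mult_distrib fps_X_power_mult_nth geom_power_nth)
  have "0 < int (a j) * fps_nth ((1 - fps_X) ^ 0 * (fps_X * geom) ^ j) j"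
    unfolding term_nth using assms by simp
  also have "\<dots> \<le> fps_nth ((1 - fps_X) ^ 0 * face_series n a) j"
    unfolding one_minus_X_power_mult_face_series_nth term_nth
    by (rule member_le_sum) (use assms in auto)
  finally show ?thesis by auto
qed

text \<open>For \<open>r = l + 1 > n\<close> the series \<open>p = (1-t)\<^sup>l H\<close> is a polynomial. If \<open>(1-t) p\<close> has nonnegative
  coefficients, those of \<open>p\<close> are nonnegative and nondecreasing; as they end in zeros, all of them
  vanish.\<close>

lemma nonneg_coeffs_imp_exponent_le:
  assumes nonneg: "\<And>i. fps_nth ((1 - fps_X) ^ r * face_series n a) i \<ge> 0"
    and nonzero: "face_series n a \<noteq> 0"
  shows "r \<le> n"
proof (rule ccontr)
  assume "\<not> r \<le> n"
  then obtain l where r: "r = Suc l" and "n \<le> l"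
    by (cases r) auto
  define p where "p = (1 - fps_X) ^ l * face_series n a"
  have step: "fps_nth p i \<le> fps_nth p (Suc i)" for i
    using nonneg[of "Suc i"] by (simp add: r mult.assoc one_minus_X_mult_nth_Suc flip: p_def)
  have p0: "0 \<le> fps_nth p 0"
    using nonneg[of 0] by (simp add: r mult.assoc one_minus_X_mult_nth_0 flip: p_def)
  have large: "fps_nth p i = 0" if "l < i" for i
    using that \<open>n \<le> l\<close> unfolding p_def one_minus_X_power_mult_face_series_nth
    by (intro sum.neutral) (auto simp: one_minus_X_power_mult_face_term_nth)
  have "fps_nth p i = 0" for i
  proof -
    have "0 \<le> fps_nth p i"
      using p0 lift_Suc_mono_le[of "fps_nth p" 0 i] step by force
    moreover have "fps_nth p i \<le> fps_nth p (i + Suc l)"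
      by (rule lift_Suc_mono_le[of "fps_nth p"]) (use step in auto)
    ultimately show ?thesis using large[of "i + Suc l"] by simp
  qed
  then have "p = 0" by (simp add: fps_ext)
  moreover have "face_series n a = geom ^ l * p"
  proof -
    have "geom ^ l * p = ((1 - fps_X) ^ l * geom ^ l) * face_series n a"
      by (simp only: p_def ac_simps)
    then show ?thesis
      by (simp only: one_minus_X_power_mult_geom_power(1)[of l 0, unfolded add_0_right power_0] mult_1_left)
  qed
  ultimately show False using nonzero by simp
qed

text \<open>The Hilbert depth is the maximum of the left-hand set; on the right, finitely many exponents and
  coefficients decide.\<close>

proposition nonneg_exponents_face_series:
  assumes "face_series n a \<noteq> 0"
  shows "{r. \<forall>i. fps_nth ((1 - fps_X) ^ r * face_series n a) i \<ge> 0} =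
    {d. d \<le> n \<and> (\<forall>k\<le>d. (\<Sum>j=0..k. (-1) ^ (k - j) * int ((d - j) choose (k - j)) * int (a j)) \<ge> 0)}"
proof (rule Collect_cong, rule iffI)
  fix r assume *: "\<forall>i. fps_nth ((1 - fps_X) ^ r * face_series n a) i \<ge> 0"
  then have "r \<le> n" using assms nonneg_coeffs_imp_exponent_le by blast
  then show "r \<le> n \<and> (\<forall>k\<le>r. (\<Sum>j=0..k. (-1) ^ (k - j) * int ((r - j) choose (k - j)) * int (a j)) \<ge> 0)"
    using * by (simp flip: one_minus_X_power_mult_face_series_nth_le[where n = n])
next
  fix d
  assume *: "d \<le> n \<and> (\<forall>k\<le>d. (\<Sum>j=0..k. (-1) ^ (k - j) * int ((d - j) choose (k - j)) * int (a j)) \<ge> 0)"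
  show "\<forall>i. fps_nth ((1 - fps_X) ^ d * face_series n a) i \<ge> 0"
  proof
    fix i show "fps_nth ((1 - fps_X) ^ d * face_series n a) i \<ge> 0"
    proof (cases "i \<le> d")
      case True
      then show ?thesis using * by (simp add: one_minus_X_power_mult_face_series_nth_le)
    qed (simp add: one_minus_X_power_mult_face_series_nth_gt)
  qed
qed

text \<open>The family of all subsets of \<open>{1..n}\<close> has the series \<open>(1 + t/(1-t))\<^sup>n = 1/(1-t)\<^sup>n\<close> of the
  polynomial ring. Both sides are the coefficient of \<open>t\<^sup>k\<close> in \<open>(1-t)\<^sup>d/(1-t)\<^sup>n\<close>.\<close>

lemma alternating_sum_binomial:
  assumes "k \<le> d" "d \<le> n"
  shows "(\<Sum>j=0..k. (-1) ^ (k - j) * int ((d - j) choose (k - j)) * int (n choose j)) =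
    int ((n - d + k - 1) choose k)"
proof -
  have "face_series n (\<lambda>j. n choose j) = (fps_X * geom + 1) ^ n"
    by (simp add: face_series_def binomial_ring)
  also have "\<dots> = geom ^ (d + (n - d))"
    using assms by (simp add: one_plus_X_geom add.commute)
  finally have "(1 - fps_X) ^ d * face_series n (\<lambda>j. n choose j) = geom ^ (n - d)"
    by (simp only: one_minus_X_power_mult_geom_power(2))
  then show ?thesis
    using one_minus_X_power_mult_face_series_nth_le[of k d n "\<lambda>j. n choose j"] assms
    by (simp add: geom_power_nth)
qed

section \<open>Counting monomials by their support\<close>

definition monomials_on :: "nat set set \<Rightarrow> nat \<Rightarrow> (nat \<Rightarrow>\<^sub>0 nat) set" where
  "monomials_on F i = {m. Poly_Mapping.keys m \<in> F \<and> mon_degree m = i}"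

lemma keys_add_nat: "Poly_Mapping.keys (p + q :: nat \<Rightarrow>\<^sub>0 nat) = Poly_Mapping.keys p \<union> Poly_Mapping.keys q"
  by (auto simp: in_keys_iff lookup_add)

lemma mon_degree_superset:
  assumes "finite A" "Poly_Mapping.keys m \<subseteq> A"
  shows "mon_degree m = (\<Sum>i\<in>A. Poly_Mapping.lookup m i)"
  unfolding mon_degree_def by (rule sum.mono_neutral_left) (use assms in \<open>auto simp: in_keys_iff\<close>)

lemma mon_degree_add: "mon_degree (p + q) = mon_degree p + mon_degree q"
  by (simp add: mon_degree_superset[of "Poly_Mapping.keys p \<union> Poly_Mapping.keys q"] keys_add_nat lookup_add
      sum.distrib)

lemma mon_degree_single [simp]: "mon_degree (Poly_Mapping.single a e) = e"
  by (simp add: mon_degree_def)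

lemma mon_degree_eq_0_iff: "mon_degree m = 0 \<longleftrightarrow> m = 0"
proof -
  have "mon_degree m = 0 \<longleftrightarrow> Poly_Mapping.keys m = {}"
    unfolding mon_degree_def by (subst sum_eq_0_iff) (auto simp: in_keys_iff simp del: keys_eq_empty)
  then show ?thesis by simp
qed

lemma minus_single_add_single:
  assumes "e \<le> Poly_Mapping.lookup m a"
  shows "(m - Poly_Mapping.single a e) + Poly_Mapping.single a e = (m :: nat \<Rightarrow>\<^sub>0 nat)"
  by (rule poly_mapping_eqI) (use assms in \<open>auto simp: lookup_add lookup_minus lookup_single when_def\<close>)

lemma keys_minus_single:
  "Poly_Mapping.keys (m - Poly_Mapping.single a e :: nat \<Rightarrow>\<^sub>0 nat) =
     (if Poly_Mapping.lookup m a \<le> e then Poly_Mapping.keys m - {a} else Poly_Mapping.keys m)"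
  by (auto simp: in_keys_iff lookup_minus lookup_single when_def split: if_splits)

lemma finite_monomials_on_single:
  assumes "finite T"
  shows "finite (monomials_on {T} i)"
proof (rule inj_on_finite)
  show "inj_on Poly_Mapping.lookup (monomials_on {T} i)"
    by (simp add: inj_on_def lookup_inject)
  show "Poly_Mapping.lookup ` monomials_on {T} i \<subseteq>
      {f. \<forall>x. (x \<in> T \<longrightarrow> f x \<in> {..i}) \<and> (x \<notin> T \<longrightarrow> f x = 0)}"
    using assms by (auto simp: monomials_on_def mon_degree_def in_keys_iff
        intro!: member_le_sum)
  show "finite {f. \<forall>x. (x \<in> T \<longrightarrow> f x \<in> {..i}) \<and> (x \<notin> T \<longrightarrow> f x = (0::nat))}"
    using assms by (intro finite_set_of_finite_funs) auto
qed

text \<open>Division by the variable \<open>a\<close> lowers the degree by one and keeps the support \<open>insert a T\<close>, unless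
  the exponent of \<open>a\<close> was 1, in which case the support becomes \<open>T\<close>.\<close>

lemma card_monomials_on_insert:
  assumes "finite T" "a \<notin> T"
  shows "card (monomials_on {insert a T} (Suc i)) =
    card (monomials_on {insert a T} i) + card (monomials_on {T} i)"
proof -
  let ?f = "\<lambda>m. m + Poly_Mapping.single a (1::nat)"
  have "monomials_on {insert a T} (Suc i) = ?f ` (monomials_on {insert a T} i \<union> monomials_on {T} i)"
  proof (intro equalityI subsetI)
    fix m assume m: "m \<in> monomials_on {insert a T} (Suc i)"
    then have "1 \<le> Poly_Mapping.lookup m a"
      by (auto simp: monomials_on_def in_keys_iff Suc_le_eq)
    then have eq: "m = ?f (m - Poly_Mapping.single a 1)"
      by (simp only: minus_single_add_single)
    have "mon_degree m = mon_degree (m - Poly_Mapping.single a 1) + 1"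
      by (subst eq) (simp only: mon_degree_add mon_degree_single)
    then have "m - Poly_Mapping.single a 1 \<in> monomials_on {insert a T} i \<union> monomials_on {T} i"
      using m assms by (auto simp: monomials_on_def keys_minus_single)
    with eq show "m \<in> ?f ` (monomials_on {insert a T} i \<union> monomials_on {T} i)" by blast
  next
    fix m assume "m \<in> ?f ` (monomials_on {insert a T} i \<union> monomials_on {T} i)"
    then obtain m' where "m = ?f m'" "mon_degree m' = i" "insert a (Poly_Mapping.keys m') = insert a T"
      by (force simp: monomials_on_def)
    then show "m \<in> monomials_on {insert a T} (Suc i)"
      by (simp add: monomials_on_def keys_add_nat mon_degree_add)
  qed
  moreover have "inj_on ?f X" for X by (rule inj_onI) (rule add_right_imp_eq)
  ultimately have "card (monomials_on {insert a T} (Suc i)) =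
      card (monomials_on {insert a T} i \<union> monomials_on {T} i)"
    by (simp only: card_image)
  also have "\<dots> = card (monomials_on {insert a T} i) + card (monomials_on {T} i)"
    by (rule card_Un_disjoint) (use assms in
        \<open>simp_all add: finite_monomials_on_single, auto simp: monomials_on_def\<close>)
  finally show ?thesis .
qed

lemma card_monomials_on_single:
  assumes "finite T"
  shows "int (card (monomials_on {T} i)) = fps_nth ((fps_X * geom) ^ card T) i"
  using assms
proof (induction T arbitrary: i)
  case empty
  have "monomials_on {{}} i = (if i = 0 then {0} else {})"
    by (auto simp: monomials_on_def mon_degree_def)
  then show ?case by auto
next
  case (insert a T)
  define c where "c T = Abs_fps (\<lambda>i. int (card (monomials_on {T} i)))" for T
  have c_T: "c T = (fps_X * geom) ^ card T"
    by (rule fps_ext) (simp add: c_def insert.IH)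
  \<comment> \<open>For the generating functions the recursion reads \<open>(1-t) c(insert a T) = t c(T)\<close>.\<close>
  have "(1 - fps_X) * c (insert a T) = fps_X * c T"
  proof (rule fps_ext)
    fix i
    have "monomials_on {insert a T} 0 = {}"
      by (auto simp: monomials_on_def mon_degree_eq_0_iff)
    then show "fps_nth ((1 - fps_X) * c (insert a T)) i = fps_nth (fps_X * c T) i"
      using insert.hyps
      by (cases i) (simp_all add: one_minus_X_mult_nth_Suc one_minus_X_mult_nth_0 c_def card_monomials_on_insert)
  qed
  then have "((1 - fps_X) * geom) * c (insert a T) = (fps_X * geom) * c T"
    by (simp only: ac_simps)
  then have "c (insert a T) = (fps_X * geom) ^ card (insert a T)"
    using insert.hyps by (simp only: one_minus_X_mult_geom c_T card_insert_disjoint power_Suc mult_1_left not_False_eq_True)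
  then show ?case by (simp add: c_def fps_eq_iff)
qed

proposition card_monomials_on:
  assumes F: "F \<subseteq> Pow {1..n}"
  shows "finite (monomials_on F i)"
    and "int (card (monomials_on F i)) = fps_nth (face_series n (\<lambda>j. card {T \<in> F. card T = j})) i"
proof -
  have fin: "finite F" "\<And>T. T \<in> F \<Longrightarrow> finite T"
    using F by (auto intro: finite_subset)
  have un: "monomials_on F i = (\<Union>T\<in>F. monomials_on {T} i)"
    by (auto simp: monomials_on_def)
  show "finite (monomials_on F i)"
    unfolding un using fin by (simp add: finite_monomials_on_single)
  have "int (card (monomials_on F i)) = (\<Sum>T\<in>F. int (card (monomials_on {T} i)))"
    unfolding un using fin
    by (subst card_UN_disjoint) (simp_all add: finite_monomials_on_single, auto simp: monomials_on_def)
  also have "\<dots> = (\<Sum>T\<in>F. fps_nth ((fps_X * geom) ^ card T) i)"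
    using fin by (simp add: card_monomials_on_single)
  also have "\<dots> = (\<Sum>j\<le>n. \<Sum>T | T \<in> F \<and> card T = j. fps_nth ((fps_X * geom) ^ card T) i)"
  proof (rule sum.group[symmetric])
    show "card ` F \<subseteq> {..n}"
    proof (rule image_subsetI)
      fix T assume "T \<in> F"
      then have "card T \<le> card {1..n}" using F by (intro card_mono) auto
      then show "card T \<in> {..n}" by simp
    qed
  qed (use fin in auto)
  also have "\<dots> = fps_nth (face_series n (\<lambda>j. card {T \<in> F. card T = j})) i"
    by (simp add: face_series_def fps_sum_nth fps_of_nat[symmetric])
  finally show "int (card (monomials_on F i)) = fps_nth (face_series n (\<lambda>j. card {T \<in> F. card T = j})) i" .
qed

section \<open>Polynomial rings and dimensions of spans of monomials\<close>

lemma carrier_poly_ring: "carrier (poly_ring n) = {p. \<forall>m \<in> Poly_Mapping.keys p. Poly_Mapping.keys m \<subseteq> {1..n}}"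
  and poly_ring_ops [simp]: "mult (poly_ring n) = (*)" "one (poly_ring n) = 1"
    "zero (poly_ring n) = 0" "add (poly_ring n) = (+)"
  by (simp_all add: poly_ring_def)

lemma carrier_poly_ring_closed:
  fixes p q :: "'k::field mpoly"
  shows "0 \<in> carrier (poly_ring n :: 'k mpoly ring)"
    and "1 \<in> carrier (poly_ring n :: 'k mpoly ring)"
    and "p \<in> carrier (poly_ring n) \<Longrightarrow> - p \<in> carrier (poly_ring n)"
    and "\<lbrakk>p \<in> carrier (poly_ring n); q \<in> carrier (poly_ring n)\<rbrakk> \<Longrightarrow> p + q \<in> carrier (poly_ring n)"
    and "\<lbrakk>p \<in> carrier (poly_ring n); q \<in> carrier (poly_ring n)\<rbrakk> \<Longrightarrow> p * q \<in> carrier (poly_ring n)"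
proof -
  show "\<lbrakk>p \<in> carrier (poly_ring n); q \<in> carrier (poly_ring n)\<rbrakk> \<Longrightarrow> p + q \<in> carrier (poly_ring n)"
    using Poly_Mapping.keys_add[of p q] by (auto simp: carrier_poly_ring)
  show "\<lbrakk>p \<in> carrier (poly_ring n); q \<in> carrier (poly_ring n)\<rbrakk> \<Longrightarrow> p * q \<in> carrier (poly_ring n)"
    using keys_mult[of p q] by (force simp: carrier_poly_ring keys_add_nat)
  show "p \<in> carrier (poly_ring n) \<Longrightarrow> - p \<in> carrier (poly_ring n)"
    by (simp add: carrier_poly_ring in_keys_iff)
qed (simp_all add: carrier_poly_ring)

lemma cring_poly_ring: "cring (poly_ring n :: 'k::field mpoly ring)"
proof (rule cringI)
  show "abelian_group (poly_ring n :: 'k mpoly ring)"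
  proof (rule abelian_groupI)
    fix p :: "'k mpoly" assume "p \<in> carrier (poly_ring n)"
    then show "\<exists>q\<in>carrier (poly_ring n). q \<oplus>\<^bsub>poly_ring n\<^esub> p = \<zero>\<^bsub>poly_ring n\<^esub>"
      by (intro bexI[of _ "- p"]) (simp_all add: carrier_poly_ring_closed)
  qed (simp_all add: carrier_poly_ring_closed add_ac)
  show "Group.comm_monoid (poly_ring n :: 'k mpoly ring)"
    by (rule comm_monoidI) (simp_all add: carrier_poly_ring_closed mult_ac)
qed (simp_all add: distrib_right)

lemma a_inv_poly_ring:
  assumes "p \<in> carrier (poly_ring n)"
  shows "\<ominus>\<^bsub>poly_ring n\<^esub> p = - (p :: 'k::field mpoly)"
proof -
  interpret cring "poly_ring n :: 'k mpoly ring" by (rule cring_poly_ring)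
  show ?thesis
    by (rule minus_equality) (use assms in \<open>simp_all add: carrier_poly_ring_closed\<close>)
qed

lemma subfield_poly_consts: "subfield (poly_consts :: 'k::field mpoly set) (poly_ring n)"
proof -
  let ?R = "poly_ring n :: 'k mpoly ring" and ?K = "poly_consts :: 'k mpoly set"
  interpret cring ?R by (rule cring_poly_ring)
  have sub: "?K \<subseteq> carrier ?R"
    by (auto simp: poly_consts_def carrier_poly_ring split: if_splits)
  show ?thesis
  proof (rule subfieldI)
    have "subring ?K ?R"
    proof (rule subringI)
      show "\<one>\<^bsub>?R\<^esub> \<in> ?K"
        by (auto simp: poly_consts_def simp flip: single_one)
    next
      fix p assume "p \<in> ?K"
      then show "\<ominus>\<^bsub>?R\<^esub> p \<in> ?K"
        using a_inv_poly_ring[of p n] sub by (force simp: poly_consts_def simp flip: single_uminus)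
    next
      fix p q assume "p \<in> ?K" "q \<in> ?K"
      then show "p \<otimes>\<^bsub>?R\<^esub> q \<in> ?K"
        by (auto simp: poly_consts_def mult_single)
    next
      fix p q assume "p \<in> ?K" "q \<in> ?K"
      then show "p \<oplus>\<^bsub>?R\<^esub> q \<in> ?K"
        by (auto simp: poly_consts_def simp flip: single_add)
    qed (fact sub)
    then show "subcring ?K ?R"
      by (rule subcringI) (simp add: mult.commute)
  next
    show "Units (?R\<lparr>carrier := ?K\<rparr>) = ?K - {\<zero>\<^bsub>?R\<^esub>}"
    proof (intro equalityI subsetI)
      fix p assume p: "p \<in> ?K - {\<zero>\<^bsub>?R\<^esub>}"
      then obtain c where c: "p = Poly_Mapping.single 0 c"
        by (auto simp: poly_consts_def)
      with p have "c \<noteq> 0" by auto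
      have "Poly_Mapping.single 0 (inverse c) \<in> ?K"
        by (auto simp: poly_consts_def)
      moreover have "Poly_Mapping.single 0 (inverse c) * p = 1" "p * Poly_Mapping.single 0 (inverse c) = 1"
        using c \<open>c \<noteq> 0\<close> by (simp_all add: mult_single)
      ultimately show "p \<in> Units (?R\<lparr>carrier := ?K\<rparr>)"
        using p by (auto simp: Units_def)
    qed (auto simp: Units_def)
  qed
qed

text \<open>Monomials whose span meets the kernel of \<open>h\<close> trivially have linearly independent images. Taking
  for \<open>h\<close> the identity or a quotient map covers ideals and quotient rings at once.\<close>

lemma dimension_image_monomial_span:
  fixes A :: "(nat \<Rightarrow>\<^sub>0 nat) set" and h :: "'k::field mpoly \<Rightarrow> 'a"
  assumes hom: "ring_hom_ring (poly_ring n) Q h"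
    and "finite A" and "\<And>m. m \<in> A \<Longrightarrow> Poly_Mapping.keys m \<subseteq> {1..n}"
    and "\<And>p. \<lbrakk>Poly_Mapping.keys p \<subseteq> A; h p = \<zero>\<^bsub>Q\<^esub>\<rbrakk> \<Longrightarrow> p = 0"
  shows "ring.dimension Q (card A) (h ` poly_consts) (h ` {p. Poly_Mapping.keys p \<subseteq> A})"
  using assms(2-4)
proof (induction A)
  interpret ring_hom_ring "poly_ring n" Q h by (rule hom)
  case empty
  have "h 0 = \<zero>\<^bsub>Q\<^esub>" using hom_zero by simp
  then show ?case
    using S.dimension.zero_dim by simp
next
  interpret ring_hom_ring "poly_ring n" Q h by (rule hom)
  case (insert m A)
  let ?V = "\<lambda>A. {p :: 'k mpoly. Poly_Mapping.keys p \<subseteq> A}"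
  let ?x = "Poly_Mapping.single m 1 :: 'k mpoly"
  have V: "?V (insert m A) \<subseteq> carrier (poly_ring n)"
    using insert.prems(1) by (auto simp: carrier_poly_ring)
  have V': "?V A \<subseteq> ?V (insert m A)" and x: "?x \<in> ?V (insert m A)" by auto
  have const: "poly_consts \<subseteq> carrier (poly_ring n :: 'k mpoly ring)"
    by (rule subfieldE(3)[OF subfield_poly_consts])
  \<comment> \<open>A relation between the new monomial and the others would put a nonzero polynomial into the kernel.\<close>
  have "h ?x \<notin> h ` ?V A"
  proof
    assume "h ?x \<in> h ` ?V A"
    then obtain p where p: "p \<in> ?V A" "h ?x = h p" by auto
    have carr: "?x \<in> carrier (poly_ring n)" "p \<in> carrier (poly_ring n)" "- p \<in> carrier (poly_ring n)"
      using p(1) V V' x carrier_poly_ring_closed(3)[of p n] by blast+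
    have "h (?x + - p) = h (p + - p)"
      using hom_add[of ?x "- p"] hom_add[of p "- p"] carr p(2) by simp
    then have "h (?x - p) = \<zero>\<^bsub>Q\<^esub>" using hom_zero by simp
    moreover have "Poly_Mapping.keys (?x - p) \<subseteq> insert m A"
      using p(1) keys_diff[of ?x p] by auto
    ultimately have "?x = p" using insert.prems(2) by force
    then show False using p(1) insert.hyps(2) by auto
  qed
  moreover have "S.dimension (card A) (h ` poly_consts) (h ` ?V A)"
    using insert.prems by (intro insert.IH) auto
  ultimately have "S.dimension (Suc (card A)) (h ` poly_consts)
      (S.line_extension (h ` poly_consts) (h ?x) (h ` ?V A))"
    using x V hom_closed[of ?x] by (intro S.dimension.Suc_dim) blast+
  also have "S.line_extension (h ` poly_consts) (h ?x) (h ` ?V A) =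
      h ` {Poly_Mapping.single 0 c * ?x + p | c p. p \<in> ?V A}"
  proof -
    have eq: "h (Poly_Mapping.single 0 c) \<otimes>\<^bsub>Q\<^esub> h ?x \<oplus>\<^bsub>Q\<^esub> h p = h (Poly_Mapping.single 0 c * ?x + p)"
      if "p \<in> ?V A" for c p
    proof -
      have c: "Poly_Mapping.single 0 c \<in> carrier (poly_ring n :: 'k mpoly ring)"
        using const by (auto simp: poly_consts_def)
      moreover have "?x \<in> carrier (poly_ring n)" "p \<in> carrier (poly_ring n)"
        using that x V V' by blast+
      ultimately show ?thesis
        using hom_mult[OF c, of ?x] hom_add[of "Poly_Mapping.single 0 c * ?x" p] R.m_closed[OF c, of ?x]
        by simp
    qed
    show ?thesis
    proof (intro equalityI subsetI)
      fix u assume "u \<in> S.line_extension (h ` poly_consts) (h ?x) (h ` ?V A)"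
      then obtain c p where "p \<in> ?V A" "u = h (Poly_Mapping.single 0 c) \<otimes>\<^bsub>Q\<^esub> h ?x \<oplus>\<^bsub>Q\<^esub> h p"
        by (auto simp: S.line_extension_mem_iff poly_consts_def)
      then have "u = h (Poly_Mapping.single 0 c * ?x + p)" "p \<in> ?V A"
        using eq by simp_all
      then show "u \<in> h ` {Poly_Mapping.single 0 c * ?x + p | c p. p \<in> ?V A}"
        by blast
    next
      fix u assume "u \<in> h ` {Poly_Mapping.single 0 c * ?x + p | c p. p \<in> ?V A}"
      then obtain c p where "p \<in> ?V A" "u = h (Poly_Mapping.single 0 c * ?x + p)"
        by auto
      then have "u = h (Poly_Mapping.single 0 c) \<otimes>\<^bsub>Q\<^esub> h ?x \<oplus>\<^bsub>Q\<^esub> h p" "h p \<in> h ` ?V A"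
        using eq by simp_all
      moreover have "h (Poly_Mapping.single 0 c) \<in> h ` poly_consts"
        by (auto simp: poly_consts_def)
      ultimately show "u \<in> S.line_extension (h ` poly_consts) (h ?x) (h ` ?V A)"
        unfolding S.line_extension_mem_iff by blast
    qed
  qed
  also have "{Poly_Mapping.single 0 c * ?x + p | c p. p \<in> ?V A} = ?V (insert m A)"
  proof (intro equalityI subsetI)
    fix p assume p: "p \<in> ?V (insert m A)"
    \<comment> \<open>Every polynomial in the larger span splits off its term at the new monomial.\<close>
    define c where "c = Poly_Mapping.lookup p m"
    have "Poly_Mapping.keys (p - Poly_Mapping.single m c) \<subseteq> A"
      using p by (auto simp: in_keys_iff lookup_minus lookup_single c_def when_def split: if_splits)
    moreover have "p = Poly_Mapping.single 0 c * ?x + (p - Poly_Mapping.single m c)"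
      by (simp add: mult_single)
    ultimately show "p \<in> {Poly_Mapping.single 0 c * ?x + p | c p. p \<in> ?V A}" by blast
  next
    fix q assume "q \<in> {Poly_Mapping.single 0 c * ?x + p | c p. p \<in> ?V A}"
    then obtain c p where q: "q = Poly_Mapping.single m c + p" and "p \<in> ?V A"
      by (auto simp: mult_single)
    then show "q \<in> ?V (insert m A)"
      using Poly_Mapping.keys_add[of "Poly_Mapping.single m c" p] by (auto split: if_splits)
  qed
  finally show ?case using insert.hyps by simp
qed

section \<open>Hilbert series of Stanley-Reisner rings and ideals\<close>

text \<open>For a simplicial complex \<open>\<Delta>\<close> on \<open>{1..n}\<close>, this is the ideal generated by the squarefree
  monomials of the nonfaces, described through its monomial basis.\<close>

definition stanley_reisner_ideal :: "nat \<Rightarrow> nat set set \<Rightarrow> 'k::field mpoly set" where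
  "stanley_reisner_ideal n \<Delta> =
     {p \<in> carrier (poly_ring n). \<forall>m \<in> Poly_Mapping.keys p. Poly_Mapping.keys m \<notin> \<Delta>}"

text \<open>Multiplication enlarges the supports of monomials, and supersets of nonfaces are nonfaces.\<close>

lemma ideal_stanley_reisner_ideal:
  assumes down: "\<And>S T. \<lbrakk>S \<in> \<Delta>; T \<subseteq> S\<rbrakk> \<Longrightarrow> T \<in> \<Delta>"
  shows "ideal (stanley_reisner_ideal n \<Delta> :: 'k::field mpoly set) (poly_ring n)"
proof -
  let ?R = "poly_ring n :: 'k mpoly ring" and ?I = "stanley_reisner_ideal n \<Delta> :: 'k mpoly set"
  interpret cring ?R by (rule cring_poly_ring)
  have mult: "p * q \<in> ?I" if "p \<in> ?I" "q \<in> carrier ?R" for p q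
  proof -
    have "Poly_Mapping.keys m \<notin> \<Delta>" if "m \<in> Poly_Mapping.keys (p * q)" for m
    proof -
      from that obtain a b where m: "m = a + b" "a \<in> Poly_Mapping.keys p"
        using keys_mult[of p q] by auto
      then have "Poly_Mapping.keys a \<notin> \<Delta>"
        using \<open>p \<in> ?I\<close> by (simp add: stanley_reisner_ideal_def)
      then show ?thesis using down m by (metis keys_add_nat Un_upper1)
    qed
    then show ?thesis
      using that by (simp add: stanley_reisner_ideal_def carrier_poly_ring_closed)
  qed
  show ?thesis
  proof (rule idealI)
    show "ring ?R" by (rule ring_axioms)
    show "subgroup ?I (add_monoid ?R)"
    proof (rule add.subgroupI)
      show "?I \<noteq> {}"
        by (auto simp: stanley_reisner_ideal_def carrier_poly_ring intro!: exI[of _ 0])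
    next
      fix p assume p: "p \<in> ?I"
      then have "- p \<in> ?I"
        by (simp add: stanley_reisner_ideal_def carrier_poly_ring_closed in_keys_iff)
      then show "\<ominus>\<^bsub>?R\<^esub> p \<in> ?I"
        using p by (simp add: a_inv_poly_ring stanley_reisner_ideal_def)
    next
      fix p q assume "p \<in> ?I" "q \<in> ?I"
      then show "p \<oplus>\<^bsub>?R\<^esub> q \<in> ?I"
        using Poly_Mapping.keys_add[of p q]
        by (auto simp: stanley_reisner_ideal_def carrier_poly_ring_closed)
    qed (auto simp: stanley_reisner_ideal_def)
  next
    fix a x assume ax: "a \<in> ?I" "x \<in> carrier ?R"
    show "a \<otimes>\<^bsub>?R\<^esub> x \<in> ?I" using mult[OF ax] by simp
    then show "x \<otimes>\<^bsub>?R\<^esub> a \<in> ?I" by (simp add: mult.commute)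
  qed
qed

lemma split_by_monomials:
  obtains q r :: "'k::field mpoly"
  where "p = q + r" "Poly_Mapping.keys q = Poly_Mapping.keys p \<inter> A"
    "Poly_Mapping.keys r = Poly_Mapping.keys p - A"
proof -
  define q where "q = (\<Sum>m\<in>Poly_Mapping.keys p \<inter> A. Poly_Mapping.single m (Poly_Mapping.lookup p m))"
  have lookup_q: "Poly_Mapping.lookup q k = (if k \<in> A then Poly_Mapping.lookup p k else 0)" for k
    by (auto simp: q_def lookup_sum lookup_single when_def in_keys_iff)
  show thesis
    by (rule that[of q "p - q"]) (auto simp: in_keys_iff lookup_q lookup_minus split: if_splits)
qed

text \<open>The classes of the monomials supported on faces span, since every other term of a polynomial lies
  in the ideal. They are independent, since no nonzero combination of these monomials lies in the
  ideal. The empty face makes the quotient nontrivial, so that the constants still form a field in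
  it.\<close>

proposition hilbert_series_stanley_reisner_quotient:
  assumes faces: "\<Delta> \<subseteq> Pow {1..n}" and down: "\<And>S T. \<lbrakk>S \<in> \<Delta>; T \<subseteq> S\<rbrakk> \<Longrightarrow> T \<in> \<Delta>"
    and "{} \<in> \<Delta>"
  defines "R \<equiv> poly_ring n :: 'k::field mpoly ring" and "I \<equiv> stanley_reisner_ideal n \<Delta> :: 'k mpoly set"
  shows "hilbert_series (R Quot I) ((\<lambda>p. I +>\<^bsub>R\<^esub> p) ` poly_consts) (\<lambda>i. (\<lambda>p. I +>\<^bsub>R\<^esub> p) ` homogeneous n i) =
    face_series n (\<lambda>j. card {T \<in> \<Delta>. card T = j})"
proof -
  have ideal: "ideal I R"
    unfolding R_def I_def by (rule ideal_stanley_reisner_ideal) (fact down)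
  have hom: "ring_hom_ring R (R Quot I) ((+>\<^bsub>R\<^esub>) I)"
    by (rule ideal.rcos_ring_hom_ring[OF ideal])
  have zero: "\<zero>\<^bsub>R Quot I\<^esub> = I" by (simp add: FactRing_def)
  have mem: "p \<in> I" if "p \<in> carrier R" "I +>\<^bsub>R\<^esub> p = \<zero>\<^bsub>R Quot I\<^esub>" for p
    using ideal.rcos_const_imp_mem[OF ideal that(1)] that(2) unfolding zero .
  have "\<one>\<^bsub>R\<^esub> \<notin> I"
    using \<open>{} \<in> \<Delta>\<close> by (simp add: R_def I_def stanley_reisner_ideal_def)
  interpret ring_hom_ring R "R Quot I" "(+>\<^bsub>R\<^esub>) I" by (rule hom)
  have "\<one>\<^bsub>R Quot I\<^esub> \<noteq> \<zero>\<^bsub>R Quot I\<^esub>"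
    using mem[of "\<one>\<^bsub>R\<^esub>"] hom_one \<open>\<one>\<^bsub>R\<^esub> \<notin> I\<close> by auto
  then have K: "subfield ((+>\<^bsub>R\<^esub>) I ` poly_consts) (R Quot I)"
    by (intro img_is_subfield(2)) (simp_all add: R_def subfield_poly_consts)
  have "ring.dim (R Quot I) ((+>\<^bsub>R\<^esub>) I ` poly_consts) ((+>\<^bsub>R\<^esub>) I ` homogeneous n i) =
    card (monomials_on \<Delta> i)" for i
  proof -
    let ?V = "{p :: 'k mpoly. Poly_Mapping.keys p \<subseteq> monomials_on \<Delta> i}"
    have V: "?V \<subseteq> homogeneous n i" "homogeneous n i \<subseteq> carrier R"
      using faces by (auto simp: R_def homogeneous_def carrier_poly_ring monomials_on_def)
    have "(+>\<^bsub>R\<^esub>) I ` homogeneous n i \<subseteq> (+>\<^bsub>R\<^esub>) I ` ?V"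
    proof (rule image_subsetI)
      fix p :: "'k mpoly" assume p: "p \<in> homogeneous n i"
      obtain q r where qr: "p = q + r" "Poly_Mapping.keys q = Poly_Mapping.keys p \<inter> monomials_on \<Delta> i"
        "Poly_Mapping.keys r = Poly_Mapping.keys p - monomials_on \<Delta> i"
        by (rule split_by_monomials)
      have q: "q \<in> ?V" using qr by auto
      have r: "r \<in> I"
        using p qr(3) by (auto simp: I_def stanley_reisner_ideal_def homogeneous_def carrier_poly_ring monomials_on_def)
      have carr: "q \<in> carrier R" "r \<in> carrier R"
        using q V r ideal.Icarr[OF ideal] by blast+
      have "I +>\<^bsub>R\<^esub> (q \<oplus>\<^bsub>R\<^esub> r) = (I +>\<^bsub>R\<^esub> q) \<oplus>\<^bsub>R Quot I\<^esub> (I +>\<^bsub>R\<^esub> r)"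
        using carr by (rule hom_add)
      also have "I +>\<^bsub>R\<^esub> r = \<zero>\<^bsub>R Quot I\<^esub>"
        unfolding zero by (rule R.a_rcos_zero[OF ideal r])
      also have "(I +>\<^bsub>R\<^esub> q) \<oplus>\<^bsub>R Quot I\<^esub> \<zero>\<^bsub>R Quot I\<^esub> = I +>\<^bsub>R\<^esub> q"
        by (rule S.r_zero[OF hom_closed[OF carr(1)]])
      finally have "I +>\<^bsub>R\<^esub> p = I +>\<^bsub>R\<^esub> q" by (simp add: qr(1) R_def)
      then show "I +>\<^bsub>R\<^esub> p \<in> (+>\<^bsub>R\<^esub>) I ` ?V" using q by blast
    qed
    with V(1) have "(+>\<^bsub>R\<^esub>) I ` homogeneous n i = (+>\<^bsub>R\<^esub>) I ` ?V" by blast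
    moreover have "ring.dimension (R Quot I) (card (monomials_on \<Delta> i)) ((+>\<^bsub>R\<^esub>) I ` poly_consts) ((+>\<^bsub>R\<^esub>) I ` ?V)"
    proof (rule dimension_image_monomial_span)
      show "ring_hom_ring (poly_ring n) (R Quot I) ((+>\<^bsub>R\<^esub>) I)"
        using hom by (simp add: R_def)
      show "finite (monomials_on \<Delta> i)" using faces by (rule card_monomials_on(1))
      show "Poly_Mapping.keys m \<subseteq> {1..n}" if "m \<in> monomials_on \<Delta> i" for m
        using faces that by (auto simp: monomials_on_def)
      fix p :: "'k mpoly"
      assume p: "Poly_Mapping.keys p \<subseteq> monomials_on \<Delta> i" "I +>\<^bsub>R\<^esub> p = \<zero>\<^bsub>R Quot I\<^esub>"
      then have "p \<in> I" using V by (intro mem) auto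
      then have "Poly_Mapping.keys p = {}"
        using p(1) by (auto simp: I_def stanley_reisner_ideal_def monomials_on_def simp del: keys_eq_empty)
      then show "p = 0" by simp
    qed
    ultimately show ?thesis
      using S.dimI[OF K] by (simp add: over_def)
  qed
  then show ?thesis
    using card_monomials_on(2)[OF faces] by (intro fps_ext) (simp add: hilbert_series_def)
qed

proposition hilbert_series_stanley_reisner_ideal:
  fixes n :: nat and \<Delta> :: "nat set set"
  defines "R \<equiv> poly_ring n :: 'k::field mpoly ring" and "I \<equiv> stanley_reisner_ideal n \<Delta> :: 'k mpoly set"
  shows "hilbert_series R poly_consts (\<lambda>i. I \<inter> homogeneous n i) =
    face_series n (\<lambda>j. card {T \<in> Pow {1..n} - \<Delta>. card T = j})"
proof -
  interpret cring R unfolding R_def by (rule cring_poly_ring)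
  let ?N = "Pow {1..n} - \<Delta>"
  have N: "?N \<subseteq> Pow {1..n}" by blast
  have "dim poly_consts (I \<inter> homogeneous n i) = card (monomials_on ?N i)" for i
  proof -
    have "ring.dimension R (card (monomials_on ?N i)) ((\<lambda>p. p) ` poly_consts)
        ((\<lambda>p. p) ` {p :: 'k mpoly. Poly_Mapping.keys p \<subseteq> monomials_on ?N i})"
    proof (rule dimension_image_monomial_span)
      show "ring_hom_ring (poly_ring n) R (\<lambda>p. p)"
        using ring_axioms by (intro ring_hom_ringI2 ring_hom_memI) (simp_all add: R_def)
      show "finite (monomials_on ?N i)" using N by (rule card_monomials_on(1))
    qed (auto simp: R_def monomials_on_def)
    moreover have "I \<inter> homogeneous n i = {p. Poly_Mapping.keys p \<subseteq> monomials_on ?N i}"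
      by (auto simp: I_def stanley_reisner_ideal_def homogeneous_def carrier_poly_ring monomials_on_def)
    moreover have "subfield poly_consts R" by (simp add: R_def subfield_poly_consts)
    ultimately show ?thesis
      using dimI by (simp add: over_def)
  qed
  then show ?thesis
    using card_monomials_on(2)[OF N] by (intro fps_ext) (simp add: hilbert_series_def)
qed

section \<open>The edge ideal of a path\<close>

text \<open>The independent sets of vertices of the path \<open>1, \<dots>, n\<close>.\<close>

definition stable_sets :: "nat \<Rightarrow> nat set set" where
  "stable_sets n = {T. T \<subseteq> {1..n} \<and> (\<forall>i. \<not> (i \<in> T \<and> Suc i \<in> T))}"

text \<open>A monomial is a multiple of some generator \<open>x\<^sub>i x\<^sub>i\<^sub>+\<^sub>1\<close> iff its support contains two consecutive
  indices.\<close>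

lemma path_ideal_eq:
  "path_ideal n = (stanley_reisner_ideal n (stable_sets n) :: 'k::field mpoly set)"
proof
  let ?R = "poly_ring n :: 'k mpoly ring" and ?I = "stanley_reisner_ideal n (stable_sets n) :: 'k mpoly set"
  let ?G = "{var i * var (Suc i) |i. 1 \<le> i \<and> i < n} :: 'k mpoly set"
  let ?e = "\<lambda>i. Poly_Mapping.single i (1::nat)"
  interpret cring ?R by (rule cring_poly_ring)
  have gen: "var i * var (Suc i) = (Poly_Mapping.single (?e i + ?e (Suc i)) 1 :: 'k mpoly)" for i
    by (simp add: var_def mult_single)
  have G_I: "?G \<subseteq> ?I"
  proof clarify
    fix i assume "1 \<le> i" "i < n"
    moreover have "Poly_Mapping.keys (?e i + ?e (Suc i)) = {i, Suc i}"
      by (auto simp: keys_add_nat)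
    ultimately show "var i * var (Suc i) \<in> ?I"
      unfolding gen stanley_reisner_ideal_def carrier_poly_ring stable_sets_def by auto
  qed
  have "ideal ?I ?R"
    by (rule ideal_stanley_reisner_ideal) (auto simp: stable_sets_def)
  then show "path_ideal n \<subseteq> ?I"
    unfolding path_ideal_def using G_I by (rule genideal_minimal)
  have G: "?G \<subseteq> carrier ?R" using G_I by (auto simp: stanley_reisner_ideal_def)
  have ideal: "ideal (path_ideal n) ?R"
    unfolding path_ideal_def using G by (rule genideal_ideal)
  have monomial: "Poly_Mapping.single m c \<in> path_ideal n"
    if m: "Poly_Mapping.keys m \<subseteq> {1..n}" "Poly_Mapping.keys m \<notin> stable_sets n" for m and c :: 'k
  proof -
    from m obtain i where i: "i \<in> Poly_Mapping.keys m" "Suc i \<in> Poly_Mapping.keys m"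
      by (auto simp: stable_sets_def)
    then have "1 \<le> i" "i < n" using m by auto
    then have "var i * var (Suc i) \<in> ?G" by blast
    then have g: "var i * var (Suc i) \<in> (path_ideal n :: 'k mpoly set)"
      unfolding path_ideal_def by (rule subsetD[OF genideal_self[OF G]])
    let ?m = "m - (?e i + ?e (Suc i))"
    have "1 \<le> Poly_Mapping.lookup m i" "1 \<le> Poly_Mapping.lookup m (Suc i)"
      using i by (simp_all add: in_keys_iff)
    then have "?m + (?e i + ?e (Suc i)) = m"
      by (intro poly_mapping_eqI) (auto simp: lookup_add lookup_minus lookup_single when_def)
    then have "Poly_Mapping.single m c = Poly_Mapping.single ?m c * (var i * var (Suc i))"
      unfolding gen by (simp add: mult_single)
    moreover have "Poly_Mapping.single ?m c \<in> carrier ?R"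
      using m(1) by (auto simp: carrier_poly_ring in_keys_iff lookup_minus)
    ultimately show ?thesis
      using ideal.I_l_closed[OF ideal g] by simp
  qed
  have "p \<in> path_ideal n"
    if "\<And>m. m \<in> Poly_Mapping.keys p \<Longrightarrow> Poly_Mapping.keys m \<subseteq> {1..n} \<and> Poly_Mapping.keys m \<notin> stable_sets n"
    for p :: "'k mpoly"
    using that
  proof (induction p rule: update_induct)
    case const
    show ?case using additive_subgroup.zero_closed[OF ideal.axioms(1)[OF ideal]] by simp
  next
    case (update p m c)
    have eq: "Poly_Mapping.update m c p = Poly_Mapping.single m c + p"
      by (rule poly_mapping_eqI)
        (use update.hyps in \<open>auto simp: lookup_update lookup_add lookup_single when_def in_keys_iff\<close>)
    have "p \<in> path_ideal n"
      using update.hyps by (intro update.IH update.prems) (simp add: keys_update)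
    moreover have "Poly_Mapping.single m c \<in> path_ideal n"
      using update.hyps update.prems[of m] by (intro monomial) (simp_all add: keys_update)
    ultimately show ?case
      unfolding eq using additive_subgroup.a_closed[OF ideal.axioms(1)[OF ideal]] by simp
  qed
  then show "?I \<subseteq> path_ideal n"
    by (auto simp: stanley_reisner_ideal_def carrier_poly_ring)
qed

lemma finite_stable_sets: "finite {T \<in> stable_sets n. card T = j}"
  by (rule finite_subset[of _ "Pow {1..n}"]) (auto simp: stable_sets_def)

text \<open>A stable set of the path on \<open>n + 2\<close> vertices either avoids the last vertex, or contains it and
  then avoids the last but one.\<close>

lemma stable_sets_card_Suc:
  "{T \<in> stable_sets (Suc (Suc n)). card T = Suc j} =
    {T \<in> stable_sets (Suc n). card T = Suc j} \<union> insert (Suc (Suc n)) ` {T \<in> stable_sets n. card T = j}"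
  (is "?L = ?A \<union> insert ?v ` ?B")
proof (intro equalityI subsetI)
  fix T assume T: "T \<in> ?L"
  show "T \<in> ?A \<union> insert ?v ` ?B"
  proof (cases "?v \<in> T")
    case False
    then have "T \<subseteq> {1..Suc n}" using T by (auto simp: stable_sets_def le_Suc_eq)
    then show ?thesis using T by (auto simp: stable_sets_def)
  next
    case True
    then have "Suc n \<notin> T" using T by (auto simp: stable_sets_def)
    then have "T - {?v} \<subseteq> {1..n}" using T by (auto simp: stable_sets_def le_Suc_eq)
    then have "T - {?v} \<in> ?B" using T True by (auto simp: stable_sets_def)
    moreover have "T = insert ?v (T - {?v})" using True by blast
    ultimately show ?thesis by blast
  qed
next
  fix T assume "T \<in> ?A \<union> insert ?v ` ?B"
  then show "T \<in> ?L"
  proof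
    assume "T \<in> ?A"
    then show ?thesis by (auto simp: stable_sets_def)
  next
    assume "T \<in> insert ?v ` ?B"
    then obtain S where S: "T = insert ?v S" "S \<subseteq> {1..n}" "card S = j" "\<And>i. i \<in> S \<Longrightarrow> Suc i \<notin> S"
      by (auto simp: stable_sets_def)
    then have "finite S" "?v \<notin> S" "Suc n \<notin> S" "Suc ?v \<notin> S"
      by (auto intro: finite_subset)
    then show ?thesis using S by (auto simp: stable_sets_def)
  qed
qed

text \<open>The recursion for stable sets is Pascal's rule for these binomial coefficients.\<close>

lemma card_stable_sets: "card {T \<in> stable_sets n. card T = j} = (n + 1 - j) choose j"
proof (induction n arbitrary: j rule: induct_nat_012)
  case 0
  have "{T \<in> stable_sets 0. card T = j} = (if j = 0 then {{}} else {})"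
    by (auto simp: stable_sets_def)
  then show ?case by simp
next
  case 1
  have "{T \<in> stable_sets (Suc 0). card T = j} = (if j = 0 then {{}} else if j = 1 then {{1}} else {})"
    by (auto simp: stable_sets_def subset_singleton_iff)
  then show ?case by simp
next
  case (ge2 n)
  show ?case
  proof (cases j)
    case 0
    have "{T \<in> stable_sets (Suc (Suc n)). card T = 0} = {{}}"
      by (auto simp: stable_sets_def dest: finite_subset)
    then show ?thesis using 0 by simp
  next
    case (Suc i)
    let ?v = "Suc (Suc n)"
    have notin: "?v \<notin> T" if "T \<in> stable_sets n \<or> T \<in> stable_sets (Suc n)" for T
      using that by (auto simp: stable_sets_def)
    then have "inj_on (insert ?v) {T \<in> stable_sets n. card T = i}"
      by (auto simp: inj_on_def insert_ident)
    moreover have "{T \<in> stable_sets (Suc n). card T = Suc i} \<inter> insert ?v ` {T \<in> stable_sets n. card T = i} = {}"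
      using notin by auto
    ultimately have "card {T \<in> stable_sets ?v. card T = Suc i} =
        ((Suc n + 1 - Suc i) choose Suc i) + ((n + 1 - i) choose i)"
      unfolding stable_sets_card_Suc
      by (subst card_Un_disjoint) (simp_all add: finite_stable_sets card_image ge2)
    also have "\<dots> = (?v + 1 - Suc i) choose Suc i"
    proof (cases "i \<le> n + 1")
      case True
      then have "?v + 1 - Suc i = Suc (n + 1 - i)" by simp
      then show ?thesis by simp
    qed simp
    finally show ?thesis using Suc by simp
  qed
qed

lemma card_nonstable_sets:
  "int (card {T \<in> Pow {1..n} - stable_sets n. card T = j}) = int (n choose j) - int ((n + 1 - j) choose j)"
proof -
  have "{T \<in> Pow {1..n} - stable_sets n. card T = j} =
      {T. T \<subseteq> {1..n} \<and> card T = j} - {T \<in> stable_sets n. card T = j}"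
    by auto
  moreover have "{T \<in> stable_sets n. card T = j} \<subseteq> {T. T \<subseteq> {1..n} \<and> card T = j}"
    by (auto simp: stable_sets_def)
  ultimately have "int (card {T \<in> Pow {1..n} - stable_sets n. card T = j}) =
      int (card {T. T \<subseteq> {1..n} \<and> card T = j}) - int (card {T \<in> stable_sets n. card T = j})"
    by (simp add: card_Diff_subset finite_stable_sets card_mono of_nat_diff)
  then show ?thesis
    by (simp add: card_stable_sets n_subsets)
qed

lemma all_le_iff_skip_initial:
  fixes a d :: nat
  assumes "\<And>k. k < a \<Longrightarrow> P k"
  shows "(\<forall>k\<le>d. P k) \<longleftrightarrow> (\<forall>k. a \<le> k \<and> k \<le> d \<longrightarrow> P k)"
proof (intro iffI allI impI)
  fix k assume "\<forall>k. a \<le> k \<and> k \<le> d \<longrightarrow> P k" "k \<le> d"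
  then show "P k" using assms by (cases "k < a") auto
qed blast

theorem theorem3p6:
  fixes n :: nat
  assumes "n \<ge> 2"
  shows "(hdepth_quotient n (path_ideal n :: 'k::field mpoly set) =
           Max {d. d \<le> n \<and> (\<forall>k. 1 \<le> k \<and> k \<le> d \<longrightarrow>
             (\<Sum>j=0..k. (-1) ^ (k - j) * int ((d - j) choose (k - j)) * int ((n - j + 1) choose j))
               \<ge> 0)}) \<and>
         (hdepth_ideal n (path_ideal n :: 'k::field mpoly set) =
           Max {d. d \<le> n \<and> (\<forall>k. 2 \<le> k \<and> k \<le> d \<longrightarrow>
             (\<Sum>j=0..k. (-1) ^ (k - j) * int ((d - j) choose (k - j)) * int ((n - j + 1) choose j))
               \<le> int ((n - d + k - 1) choose k))})"
proof -
  define f where "f j = card {T \<in> stable_sets n. card T = j}" for j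
  define g where "g j = card {T \<in> Pow {1..n} - stable_sets n. card T = j}" for j
  define b where "b d k = (\<Sum>j=0..k. (-1) ^ (k - j) * int ((d - j) choose (k - j)) * int ((n - j + 1) choose j))" for d k
  have f: "(\<Sum>j=0..k. (-1) ^ (k - j) * int ((d - j) choose (k - j)) * int (f j)) = b d k"
    if "k \<le> n" for d k
    unfolding b_def f_def card_stable_sets by (rule sum.cong) (use that in \<open>auto simp: Suc_diff_le\<close>)
  have g: "(\<Sum>j=0..k. (-1) ^ (k - j) * int ((d - j) choose (k - j)) * int (g j)) =
      int ((n - d + k - 1) choose k) - b d k" if "k \<le> d" "d \<le> n" for d k
  proof -
    have gf: "int (g j) = int (n choose j) - int (f j)" for j
      unfolding g_def f_def card_nonstable_sets card_stable_sets ..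
    have "k \<le> n" using that by simp
    from f[OF this] alternating_sum_binomial[OF that] show ?thesis
      by (simp only: gf right_diff_distrib sum_subtractf)
  qed
  have low: "b d 0 = 1" "b d 1 = int n - int d" for d
    using assms by (simp_all add: b_def)
  have down: "T \<in> stable_sets n" if "S \<in> stable_sets n" "T \<subseteq> S" for S T
    using that unfolding stable_sets_def by blast
  have faces: "stable_sets n \<subseteq> Pow {1..n}" "{} \<in> stable_sets n"
    by (auto simp: stable_sets_def)

  have "f 0 \<noteq> 0" by (simp add: f_def card_stable_sets)
  have "hdepth_quotient n (path_ideal n :: 'k mpoly set) =
      Max {r. \<forall>i. fps_nth ((1 - fps_X) ^ r * face_series n f) i \<ge> 0}"
    unfolding hdepth_quotient_def hdepth_def path_ideal_eq f_def
    by (subst hilbert_series_stanley_reisner_quotient[OF faces(1) down faces(2)]) simp_all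
  also have "{r. \<forall>i. fps_nth ((1 - fps_X) ^ r * face_series n f) i \<ge> 0} =
      {d. d \<le> n \<and> (\<forall>k\<le>d. b d k \<ge> 0)}"
    by (subst nonneg_exponents_face_series[OF face_series_nonzero[of 0]])
      (use \<open>f 0 \<noteq> 0\<close> in \<open>auto simp: f\<close>)
  also have "\<dots> = {d. d \<le> n \<and> (\<forall>k. 1 \<le> k \<and> k \<le> d \<longrightarrow> b d k \<ge> 0)}"
  proof (rule Collect_cong, rule conj_cong)
    fix d
    have "b d k \<ge> 0" if "k < 1" for k
      using that low(1)[of d] by simp
    then show "(\<forall>k\<le>d. b d k \<ge> 0) \<longleftrightarrow> (\<forall>k. 1 \<le> k \<and> k \<le> d \<longrightarrow> b d k \<ge> 0)"
      by (rule all_le_iff_skip_initial)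
  qed simp
  finally have quotient: "hdepth_quotient n (path_ideal n :: 'k mpoly set) =
      Max {d. d \<le> n \<and> (\<forall>k. 1 \<le> k \<and> k \<le> d \<longrightarrow> b d k \<ge> 0)}" .

  \<comment> \<open>The series of the ideal is nonzero because of the \<open>n - 1\<close> generators of degree 2.\<close>
  have "int (g 2) = int (n choose 2) - int ((n - 1) choose 2)"
    using card_nonstable_sets[of n 2] by (simp add: g_def)
  also have "\<dots> = int n - 1"
    using assms by (cases n) (simp_all add: numeral_2_eq_2)
  finally have "g 2 \<noteq> 0" using assms by auto
  have "hdepth_ideal n (path_ideal n :: 'k mpoly set) =
      Max {r. \<forall>i. fps_nth ((1 - fps_X) ^ r * face_series n g) i \<ge> 0}"
    unfolding hdepth_ideal_def hdepth_def path_ideal_eq hilbert_series_stanley_reisner_ideal g_def ..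
  also have "{r. \<forall>i. fps_nth ((1 - fps_X) ^ r * face_series n g) i \<ge> 0} =
      {d. d \<le> n \<and> (\<forall>k\<le>d. b d k \<le> int ((n - d + k - 1) choose k))}"
    by (subst nonneg_exponents_face_series[OF face_series_nonzero[of 2]])
      (use assms \<open>g 2 \<noteq> 0\<close> in \<open>auto simp: g\<close>)
  also have "\<dots> = {d. d \<le> n \<and> (\<forall>k. 2 \<le> k \<and> k \<le> d \<longrightarrow> b d k \<le> int ((n - d + k - 1) choose k))}"
  proof (rule Collect_cong, rule conj_cong)
    fix d assume "d \<le> n"
    then have "b d 0 \<le> int ((n - d + 0 - 1) choose 0)" "b d 1 \<le> int ((n - d + 1 - 1) choose 1)"
      by (simp_all only: low) auto
    then have "b d k \<le> int ((n - d + k - 1) choose k)" if "k < 2" for k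
      using less_2_cases[OF that] by auto
    then show "(\<forall>k\<le>d. b d k \<le> int ((n - d + k - 1) choose k)) \<longleftrightarrow>
        (\<forall>k. 2 \<le> k \<and> k \<le> d \<longrightarrow> b d k \<le> int ((n - d + k - 1) choose k))"
      by (rule all_le_iff_skip_initial)
  qed simp
  finally show ?thesis
    using quotient unfolding b_def by blast
qed

end
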